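(* Let $\boldsymbol{\theta}$ be a policy parameter, and let $p(\boldsymbol{\tau}^g)$ denote the occurrence probability (under $\boldsymbol{\theta}$, in the replay buffer) of a goal-state trajectory $\boldsymbol{\tau}^g$, where $\boldsymbol{\tau}^g$ ranges over a finite set $\boldsymbol{\tau}^g_1,\dots,\boldsymbol{\tau}^g_N$ with $p(\boldsymbol{\tau}^g_i)\in(0,1)$ and $\sum_{i=1}^N p(\boldsymbol{\tau}^g_i)=1$. Let $\sum_{t=1}^T r(s_t,g^e)\in\mathbb{R}$ be the accumulated reward associated with the trajectory $\boldsymbol{\tau}^g$. Define the proposal distribution $$q(\boldsymbol{\tau}^g)=\frac{1}{Z}\,p(\boldsymbol{\tau}^g)\bigl(1-p(\boldsymbol{\tau}^g)\bigr),$$ where $Z$ is the normalization factor for $q$, and define $$\eta^{\mathcal{H}}(\boldsymbol{\theta})=\mathcal{H}^w_p(\boldsymbol{\mathcal{T}}^g)=\mathbb{E}_p\left[\log\frac{1}{p(\boldsymbol{\tau}^g)}\sum_{t=1}^T r(S_t,G^e)\;\Big|\;\boldsymbol{\theta}\right],$$ $$\eta^{\mathcal{L}}(\boldsymbol{\theta})=Z\cdot\mathbb{E}_q\left[\sum_{t=1}^T r(S_t,G^e)\;\Big|\;\boldsymbol{\theta}\right].$$ Then the surrogate $\eta^{\mathcal{L}}(\boldsymbol{\theta})$ is a lower bound of the objective function $\eta^{\mathcal{H}}(\boldsymbol{\theta})$, i.e. $\eta^{\mathcal{L}}(\boldsymbol{\theta})<\eta^{\mathcal{H}}(\boldsymb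ol{\theta})$.
   Context: Multi-goal reinforcement learning setting: an agent receives a goal $g^e$ (a value of a random variable $G^e$) at the start of an episode and interacts with the environment for $T$ timesteps; at time $t$ it observes a state $s_t$ (a value of $S_t$), performs an action $a_t$, and receives a reward $r(s_t,g^e)\in\mathbb{R}$ conditioned on the goal. A trajectory is $\boldsymbol{\tau}=s_1,a_1,s_2,a_2,\dots,s_{T-1},a_{T-1},s_T$. Each state is a concatenation of an achieved goal-state and a context state; the sequence of achieved goal-states along $\boldsymbol{\tau}$ is the goal-state trajectory $\boldsymbol{\tau}^g$, a value of the random variable $\boldsymbol{\mathcal{T}}^g$. The joint probability of trajectories and goals in the replay buffer $\mathcal{R}$, for a policy with parameter $\boldsymbol{\theta}$, is $p_{\mathcal{R}}(\boldsymbol{\tau}^g,g^e\mid\boldsymbol{\theta})$, and $p(\boldsymbol{\tau}^g)$ is shorthand for $\sum_{g^e}p_{\mathcal{R}}(\boldsymbol{\tau}^g,g^e\mid\boldsymbol{\theta})$. Expectations $\mathbb{E}_p$ and $\mathbb{E}_q$ are sums over goal-state trajectories $\boldsymbol{\tau}^g$ weighted by $p(\boldsymbol{\tau}^g)$ and $q(\boldsymbol{\tau}^g)$ respectively, with the accumulated reward $\sum_{t=1}^T r(s_t,g^e)$ treated as a weight $w(\boldsymbol{\tau}^g)$ attached to $\boldsymbol{\tau}^g$. Thus $\mathcal{H}^w_p(\boldsymbol{\mathcal{T}}^g)$ is the weighted entropy $-\sum_{k} w_k p_k\log p_k$, where $p_k$ is the probability of the $k$-th elementary event (goal-state trajectory)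 and $w_k$ its weight, here the accumulated reward. $\log$ is the natural logarithm.
   Formalization: The accumulated rewards are assumed non-negative on every trajectory and not all zero; for arbitrary real rewards the claim fails (all rewards 0 gives equality, all accumulated rewards -1 reverses the inequality). *)

theory Defs
  imports "HOL-Probability.Probability"
begin

(* A state is a pair (achieved goal-state, context); times run over 1, ..., T. *)

definition goal_state_traj :: "nat \<Rightarrow> (nat \<Rightarrow> 'ag \<times> 'ctx) \<Rightarrow> 'ag list" where
  "goal_state_traj T s = map (\<lambda>t. fst (s t)) [1..<Suc T]"

definition acc_reward ::
  "('ag \<times> 'ctx \<Rightarrow> 'goal \<Rightarrow> real) \<Rightarrow> nat \<Rightarrow> (nat \<Rightarrow> 'ag \<times> 'ctx) \<Rightarrow> 'goal \<Rightarrow> real" where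
  "acc_reward r T s g = (\<Sum>t=1..T. r (s t) g)"

(* pR \<theta> is the joint distribution, in the replay buffer, of goal-state trajectories
   and goals under the policy with parameter \<theta>. *)
definition traj_prob ::
  "('theta \<Rightarrow> ('ag list \<times> 'goal) pmf) \<Rightarrow> 'theta \<Rightarrow> 'ag list \<Rightarrow> real" where
  "traj_prob pR \<theta> \<tau> = (\<Sum>\<^sub>\<infinity>g. pmf (pR \<theta>) (\<tau>, g))"

definition expect :: "'a set \<Rightarrow> ('a \<Rightarrow> real) \<Rightarrow> ('a \<Rightarrow> real) \<Rightarrow> real" where
  "expect A p f = (\<Sum>\<tau>\<in>A. p \<tau> * f \<tau>)"

definition weighted_entropy :: "'a set \<Rightarrow> ('a \<Rightarrow> real) \<Rightarrow> ('a \<Rightarrow> real) \<Rightarrow> real" where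
  "weighted_entropy A w p = - (\<Sum>\<tau>\<in>A. w \<tau> * p \<tau> * ln (p \<tau>))"

definition proposal_Z :: "'a set \<Rightarrow> ('a \<Rightarrow> real) \<Rightarrow> real" where
  "proposal_Z A p = (\<Sum>\<tau>\<in>A. p \<tau> * (1 - p \<tau>))"

definition proposal :: "'a set \<Rightarrow> ('a \<Rightarrow> real) \<Rightarrow> 'a \<Rightarrow> real" where
  "proposal A p \<tau> = 1 / proposal_Z A p * (p \<tau> * (1 - p \<tau>))"

definition eta_H :: "'a set \<Rightarrow> ('a \<Rightarrow> real) \<Rightarrow> ('a \<Rightarrow> real) \<Rightarrow> real" where
  "eta_H A p w = expect A p (\<lambda>\<tau>. ln (1 / p \<tau>) * w \<tau>)"

definition eta_L :: "'a set \<Rightarrow> ('a \<Rightarrow> real) \<Rightarrow> ('a \<Rightarrow> real) \<Rightarrow> real" where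
  "eta_L A p w = proposal_Z A p * expect A (proposal A p) w"

lemma eta_H_eq_weighted_entropy:
  assumes "\<And>\<tau>. \<tau> \<in> A \<Longrightarrow> 0 < p \<tau>"
  shows "eta_H A p w = weighted_entropy A w p"
  using assms by (auto simp: eta_H_def expect_def weighted_entropy_def ln_div
      simp flip: sum_negf intro!: sum.cong)

lemma proposal_Z_pos:
  assumes "finite A" and "\<And>\<tau>. \<tau> \<in> A \<Longrightarrow> p \<tau> \<in> {0<..<1}" and "(\<Sum>\<tau>\<in>A. p \<tau>) = 1"
  shows "0 < proposal_Z A p"
proof -
  have "A \<noteq> {}"
    using assms(3) by auto
  then show ?thesis
    unfolding proposal_Z_def using assms(1,2) by (intro sum_pos) auto
qed

lemma sum_proposal:
  assumes "finite A" and "\<And>\<tau>. \<tau> \<in> A \<Longrightarrow> p \<tau> \<in> {0<..<1}" and "(\<Sum>\<tau>\<in>A. p \<tau>) = 1"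
  shows "(\<Sum>\<tau>\<in>A. proposal A p \<tau>) = 1"
proof -
  have "(\<Sum>\<tau>\<in>A. proposal A p \<tau>) = 1 / proposal_Z A p * proposal_Z A p"
    by (simp add: proposal_def proposal_Z_def sum_distrib_left)
  then show ?thesis
    using proposal_Z_pos[OF assms] by simp
qed

end

theory Submission
  imports Defs
begin

text \<open>The factor \<open>Z\<close> cancels the normalization of \<open>q\<close>, so the
  surrogate is an expectation under \<open>p\<close> itself, with \<open>1 - p \<tau>\<close> where
  the objective has \<open>ln (1 / p \<tau>)\<close> (\<open>eta_L_eq_expect\<close>). Since
  \<open>1 - p\<close> is the tangent of \<open>- ln p\<close> at \<open>p = 1\<close> and
  \<open>- ln\<close> is strictly convex, \<open>1 - p < ln (1 / p)\<close> on (0,1)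
  (\<open>ln_less_minus_one\<close>). Weighting by nonnegative rewards, not all zero, and summing
  keeps the strict inequality (\<open>eta_L_less_eta_H\<close>).\<close>

lemma ln_less_minus_one:
  fixes x :: real
  assumes "0 < x" "x \<noteq> 1"
  shows "ln x < x - 1"
  using ln_le_minus_one[OF assms(1)] ln_eq_minus_one[OF assms(1)] assms(2) by fastforce

lemma eta_L_eq_expect:
  assumes "proposal_Z A p \<noteq> 0"
  shows "eta_L A p w = expect A p (\<lambda>\<tau>. (1 - p \<tau>) * w \<tau>)"
  using assms by (simp add: eta_L_def expect_def proposal_def sum_distrib_left mult.assoc)

text \<open>Both conditions on \<open>w\<close> matter: a negative weight reverses the inequality
  between the corresponding terms, and if all weights vanish both sides are 0.\<close>

lemma eta_L_less_eta_H:
  assumes "finite A" and p: "\<And>\<tau>. \<tau> \<in> A \<Longrightarrow> p \<tau> \<in> {0<..<1}" and "(\<Sum>\<tau>\<in>A. p \<tau>) = 1"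
    and w: "\<And>\<tau>. \<tau> \<in> A \<Longrightarrow> 0 \<le> w \<tau>" and "\<exists>\<tau>\<in>A. w \<tau> \<noteq> 0"
  shows "eta_L A p w < eta_H A p w"
proof -
  have less: "1 - p \<tau> < ln (1 / p \<tau>)" if "\<tau> \<in> A" for \<tau>
    using ln_less_minus_one[of "p \<tau>"] p[OF that] by (simp add: ln_div)
  have "expect A p (\<lambda>\<tau>. (1 - p \<tau>) * w \<tau>) < expect A p (\<lambda>\<tau>. ln (1 / p \<tau>) * w \<tau>)"
    unfolding expect_def
  \<comment> \<open>Trajectories of weight 0 contribute equally to both sums, so strictness can only
    come from one of positive weight.\<close>
  proof (rule sum_strict_mono_ex1[OF assms(1)])
    show "\<forall>\<tau>\<in>A. p \<tau> * ((1 - p \<tau>) * w \<tau>) \<le> p \<tau> * (ln (1 / p \<tau>) * w \<tau>)"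
    proof
      fix \<tau> assume "\<tau> \<in> A"
      then show "p \<tau> * ((1 - p \<tau>) * w \<tau>) \<le> p \<tau> * (ln (1 / p \<tau>) * w \<tau>)"
        using less[of \<tau>] p[of \<tau>] w[of \<tau>] by (intro mult_left_mono mult_right_mono) auto
    qed
    obtain \<tau> where "\<tau> \<in> A" "w \<tau> \<noteq> 0"
      using assms(5) by blast
    moreover from this have "0 < w \<tau>"
      using w[of \<tau>] by simp
    ultimately have "p \<tau> * ((1 - p \<tau>) * w \<tau>) < p \<tau> * (ln (1 / p \<tau>) * w \<tau>)"
      using less[of \<tau>] p[of \<tau>] by (intro mult_strict_left_mono mult_strict_right_mono) auto
    with \<open>\<tau> \<in> A\<close>
    show "\<exists>\<tau>\<in>A. p \<tau> * ((1 - p \<tau>) * w \<tau>) < p \<tau> * (ln (1 / p \<tau>) * w \<tau>)" ..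
  qed
  moreover have "proposal_Z A p \<noteq> 0"
    using proposal_Z_pos[OF assms(1-3)] by simp
  ultimately show ?thesis
    by (simp add: eta_L_eq_expect eta_H_def)
qed

text \<open>The maps \<open>s\<close> and \<open>ge\<close> pick, for each goal-state trajectory, a
  state sequence projecting to it and a goal, which makes the accumulated reward a weight on
  goal-state trajectories.\<close>

theorem theorem1:
  fixes pR :: "'theta \<Rightarrow> ('ag list \<times> 'goal) pmf"
    and \<theta> :: 'theta
    and r :: "'ag \<times> 'ctx \<Rightarrow> 'goal \<Rightarrow> real"
    and T :: nat
    and \<T> :: "'ag list set"
    and s :: "'ag list \<Rightarrow> nat \<Rightarrow> 'ag \<times> 'ctx"
    and ge :: "'ag list \<Rightarrow> 'goal"
  assumes "finite \<T>"
    and "\<And>\<tau>. \<tau> \<in> \<T> \<Longrightarrow> traj_prob pR \<theta> \<tau> \<in> {0<..<1}"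
    and "(\<Sum>\<tau>\<in>\<T>. traj_prob pR \<theta> \<tau>) = 1"
    and "\<And>\<tau>. \<tau> \<in> \<T> \<Longrightarrow> goal_state_traj T (s \<tau>) = \<tau>"
    and "\<And>\<tau>. \<tau> \<in> \<T> \<Longrightarrow> 0 \<le> acc_reward r T (s \<tau>) (ge \<tau>)"
    and "\<exists>\<tau>\<in>\<T>. acc_reward r T (s \<tau>) (ge \<tau>) \<noteq> 0"
  shows "eta_L \<T> (traj_prob pR \<theta>) (\<lambda>\<tau>. acc_reward r T (s \<tau>) (ge \<tau>))
       < eta_H \<T> (traj_prob pR \<theta>) (\<lambda>\<tau>. acc_reward r T (s \<tau>) (ge \<tau>))"
  by (rule eta_L_less_eta_H[OF assms(1,2,3,5,6)])

end
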